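(* Suppose $a\in C^2(\mathbb{R})$ satisfies $a'>0$ and $a''>0$ on $\mathbb{R}$. Let $N\geq 6$ and let $\mathcal{X}=\{X_i\}_{i=1}^N\subset K_a$. If there exists a two-dimensional plane $\mathcal{P}\subset\mathbb{R}^{3\times 2}$ such that $\mathcal{X}\subset K_a\cap\mathcal{P}$, then $\mathcal{X}$ does not have an order that forms a $T_N$ configuration.
   Context: A two-dimensional plane in $\mathbb{R}^{3\times 2}$ means a two-dimensional affine subspace (not necessarily through the origin). Given $a\in C^2(\mathbb{R})$, fix a function $F$ with $F'=a$, and define $$K_a:=\left\{\begin{bmatrix} u & v \\ a(v) & u \\ u a(v) & \frac{u^2}{2}+F(v) \end{bmatrix}:u,v\in\mathbb{R}\right\}\subset\mathbb{R}^{3\times 2}.$$ $T_N$ configuration: a set contains rank-one connections if it contains $A\neq B$ with $\mathrm{rank}(A-B)=1$. An ordered set of $N\geq 4$ distinct matrices $\{X_i\}_{i=1}^N\subset\mathbb{R}^{m\times n}$ without rank-one connections is said to form a $T_N$ configuration if there exist matrices $P_0,C_1,\dots,C_N\in\mathbb{R}^{m\times n}$ and real numbers $\kappa_1,\dots,\kappa_N>1$ such that $\mathrm{rank}(C_i)=1$ for all $i$, $\sum_{i=1}^N C_i=0$, and $X_i=P_0+C_1+\dots+C_{i-1}+\kappa_iC_i$ for $i=1,\dots,N$. A set $\{X_i\}_{i=1}^N$ has an order that forms a $T_N$ configuration if for some permutation $\sigma$ of $\{1,\dots,N\}$ the ordered set $(X_{\sigma(1)},\dots,X_{\sigma(N)})$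 forms a $T_N$ configuration. *)

theory Defs
  imports "HOL-Analysis.Analysis"
begin

definition C2_fun :: "(real \<Rightarrow> real) \<Rightarrow> bool" where
  "C2_fun f \<longleftrightarrow> f C1_differentiable_on UNIV \<and> deriv f C1_differentiable_on UNIV"

(* The type real^2^3 consists of 3 x 2 matrices, listed below by rows. F stands for an
   antiderivative of a; its choice (up to a constant) is left to the user of the definition. *)
definition K_set :: "(real \<Rightarrow> real) \<Rightarrow> (real \<Rightarrow> real) \<Rightarrow> (real^2^3) set" where
  "K_set a F =
    {vector [vector [u, v],
             vector [a v, u],
             vector [u * a v, u\<^sup>2 / 2 + F v]] | u v. True}"

definition has_rank_one_connections :: "(real^'n^'m) set \<Rightarrow> bool" where
  "has_rank_one_connections S \<longleftrightarrow> (\<exists>A\<in>S. \<exists>B\<in>S. A \<noteq> B \<and> rank (A - B) = 1)"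

(* Families X_1, ..., X_N are functions on nat of which only the values on {1..N} matter. *)
definition forms_TN :: "nat \<Rightarrow> (nat \<Rightarrow> real^'n^'m) \<Rightarrow> bool" where
  "forms_TN N X \<longleftrightarrow>
     N \<ge> 4 \<and> inj_on X {1..N} \<and> \<not> has_rank_one_connections (X ` {1..N}) \<and>
     (\<exists>P0 C. \<exists>\<kappa> :: nat \<Rightarrow> real.
        (\<forall>i\<in>{1..N}. \<kappa> i > 1 \<and> rank (C i) = 1) \<and>
        (\<Sum>i=1..N. C i) = 0 \<and>
        (\<forall>i\<in>{1..N}. X i = P0 + (\<Sum>j=1..<i. C j) + \<kappa> i *\<^sub>R C i))"

definition has_TN_order :: "nat \<Rightarrow> (nat \<Rightarrow> real^'n^'m) \<Rightarrow> bool" where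
  "has_TN_order N X \<longleftrightarrow> (\<exists>\<sigma>. \<sigma> permutes {1..N} \<and> forms_TN N (X \<circ> \<sigma>))"

definition affine_plane :: "'a::euclidean_space set \<Rightarrow> bool" where
  "affine_plane P \<longleftrightarrow> affine P \<and> aff_dim P = 2"

end

theory Submission
  imports Defs
begin

text \<open>The whole polygon of a planar $T_N$ configuration lies in the plane. There are two independent
  rank-one directions $A$, $B$ in the plane, since otherwise there would be rank-one connections;
  all $2\times 2$ minors of $sA + tB$ are then multiples of $st$, so in the coordinates $(s,t)$ the
  polygon is a staircase with axis-parallel edges. It cannot happen that, for some $i$, all other
  $X_j$ lie in the same pair of opposite open quadrants around $X_i$: having passed $X_i$, the
  polygon enters one of the quadrants and never leaves it.

  On $K_a$ this does happen. For two points write $\Delta$ for differences, $\bar a$ for the mean of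
  the two values of $a$, and $T = \bar a\,\Delta v - \Delta F$. The minors of the difference satisfy
  $M_{12} = (\Delta u)^2 - \Delta v\,\Delta a$ and $M_{23} = -\bar a M_{12} - T\,\Delta a$, where
  $T\,\Delta a > 0$ by strict convexity of $F'=a$ unless $\Delta v = 0$. As $M_{12}$ and $M_{23}$
  are constant multiples of $\Delta s\,\Delta t$, the sign of $\Delta s\,\Delta t$ is, up to a
  constant factor, that of $\beta - \bar a$ for a constant $\beta$, and it is constant in $j$ when
  $i$ maximises $|a(v_i)-\beta|$.\<close>

section \<open>Closed polygons with axis-parallel edges\<close>

text \<open>From the vertex \<open>(p n, r n)\<close> the polygon moves a fraction
  \<open>l n\<close> of the way to the point \<open>(x n, y n)\<close>. Edge \<open>i\<close> is
  horizontal and stops short of point \<open>i\<close>; the next edge enters an open quadrant around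
  that point, and all later targets lie in this quadrant, so the height \<open>r i\<close> is never
  regained.\<close>

lemma closed_staircase_no_monotone_corner_aux:
  fixes x y p r l :: "nat \<Rightarrow> real"
  assumes N: "N \<ge> 2" and per: "r (i + N) = r i"
    and l: "\<And>n. 0 < l n \<and> l n < 1"
    and step: "\<And>n. p (Suc n) = p n + l n * (x n - p n) \<and> r (Suc n) = r n + l n * (y n - r n)"
    and axis: "\<And>n. x n = p n \<or> y n = r n"
    and i: "y i = r i" "x i \<noteq> p i"
    and pos: "\<And>n. i < n \<Longrightarrow> n < i + N \<Longrightarrow> (x n - x i) * (y n - y i) > 0"
  shows False
proof -
  \<comment> \<open>The side of \<open>x i\<close> on which the polygon stands after step
    \<open>i\<close>; it is the side of \<open>p i\<close>, as \<open>l i < 1\<close>.\<close>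
  define s where "s = sgn (p (Suc i) - x i)"
  have D: "p (Suc i) - x i = (1 - l i) * (p i - x i)"
    using step[of i] by (simp add: algebra_simps)
  then have "p (Suc i) - x i \<noteq> 0" using l[of i] i by auto
  then have s: "s = 1 \<or> s = -1" "s * (p (Suc i) - x i) > 0"
    by (auto simp: s_def sgn_if)
  have sgn_iff: "s * (x n - x i) > 0 \<longleftrightarrow> s * (y n - y i) > 0" if "i < n" "n < i + N" for n
    using pos[OF that] s(1) by (auto simp: zero_less_mult_iff)
  have mix: "s * (a + t * (b - a) - c) > 0"
    if "s * (a - c) \<ge> 0" "s * (b - c) > 0" "0 < t" "t < 1" for a b c t
  proof -
    have "s * (a + t * (b - a) - c) = (1 - t) * (s * (a - c)) + t * (s * (b - c))"
      by (simp add: algebra_simps)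
    also have "\<dots> > 0" using that by (intro add_nonneg_pos mult_nonneg_nonneg[of "1 - t"] mult_pos_pos[of t]) auto
    finally show ?thesis .
  qed
  have r1: "r (Suc i) = y i" using step[of i] i by simp
  \<comment> \<open>The start is \<open>i + 2\<close> because the vertex \<open>i + 1\<close> still
    has height \<open>y i\<close>, on the boundary of the quadrant; hence the weak inequality at the
    initial point in \<open>mix\<close>.\<close>
  have "s * (p n - x i) > 0 \<and> s * (r n - y i) > 0" if "i + 2 \<le> n" "n \<le> i + N" for n
    using that
  proof (induction n rule: dec_induct)
    case base
    have "y (Suc i) \<noteq> y i" using pos[of "Suc i"] N by auto
    then have x1: "x (Suc i) = p (Suc i)" using axis[of "Suc i"] r1 by auto
    then have "s * (y (Suc i) - y i) > 0" using s(2) sgn_iff[of "Suc i"] N by simp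
    then show ?case
      using step[of "Suc i"] x1 s(2) mix[of "r (Suc i)" "y i" "y (Suc i)" "l (Suc i)"] l[of "Suc i"] r1
      by simp
  next
    case (step n)
    then have IH: "s * (p n - x i) > 0" "s * (r n - y i) > 0" by auto
    \<comment> \<open>The target shares one coordinate with the vertex, which gives that coordinate
      the sign \<open>s\<close>; \<open>sgn_iff\<close> transfers it to the other.\<close>
    then have "s * (x n - x i) > 0 \<and> s * (y n - y i) > 0"
      using axis[of n] sgn_iff[of n] step.hyps step.prems by auto
    then show ?case
      using assms(4)[of n] mix[of "p n" "x i" "x n" "l n"] mix[of "r n" "y i" "y n" "l n"] l[of n] IH
      by simp
  qed
  from this[of "i + N"] show False using N per i by simp
qed

text \<open>Scaling the second coordinate by \<open>\<sigma>\<close> normalises the pair of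
  quadrants, and exchanging coordinates makes edge \<open>i\<close> horizontal.\<close>

lemma closed_staircase_no_monotone_corner:
  fixes x y p r l :: "nat \<Rightarrow> real"
  assumes N: "N \<ge> 2" and per: "p (i + N) = p i" "r (i + N) = r i"
    and l: "\<And>n. 0 < l n \<and> l n < 1"
    and step: "\<And>n. p (Suc n) = p n + l n * (x n - p n) \<and> r (Suc n) = r n + l n * (y n - r n)"
    and axis: "\<And>n. x n = p n \<or> y n = r n"
    and ne: "x i \<noteq> p i \<or> y i \<noteq> r i"
    and pos: "\<And>n. i < n \<Longrightarrow> n < i + N \<Longrightarrow> \<sigma> * ((x n - x i) * (y n - y i)) > 0"
  shows False
proof -
  have "\<sigma> \<noteq> 0" using pos[of "Suc i"] N by auto
  define y' r' where "y' n = \<sigma> * y n" and "r' n = \<sigma> * r n" for n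
  have step': "p (Suc n) = p n + l n * (x n - p n) \<and> r' (Suc n) = r' n + l n * (y' n - r' n)" for n
    using step[of n] by (simp add: y'_def r'_def right_diff_distrib distrib_left mult.left_commute)
  have axis': "x n = p n \<or> y' n = r' n" for n
    using axis[of n] by (auto simp: y'_def r'_def)
  have pos': "(x n - x i) * (y' n - y' i) > 0" if "i < n" "n < i + N" for n
    using pos[OF that] by (simp add: y'_def algebra_simps)
  have per': "r' (i + N) = r' i" using per by (simp add: r'_def)
  show False
  proof (cases "x i = p i")
    case False
    then have "y' i = r' i" using axis' by blast
    with False show False
      using closed_staircase_no_monotone_corner_aux[of N r' i l p x y'] N per' l step' axis' pos' by blast
  next
    case True
    then have "y' i \<noteq> r' i" using ne \<open>\<sigma> \<noteq> 0\<close> by (simp add: y'_def r'_def)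
    with True show False
      using closed_staircase_no_monotone_corner_aux[of N p i l r' y' x] N per(1) l step' axis' pos'
      by (metis mult.commute)
  qed
qed

section \<open>Strict convexity and the signs of the two minors\<close>

lemma trapezoid_strict:
  fixes a F :: "real \<Rightarrow> real"
  assumes a: "\<And>x. (a has_real_derivative a' x) (at x)"
    and mono: "\<And>x y. x < y \<Longrightarrow> a' x < a' y"
    and F: "\<And>x. (F has_real_derivative a x) (at x)"
    and "v < w"
  shows "F w - F v < (a v + a w) / 2 * (w - v)"
proof -
  \<comment> \<open>The trapezoid error as a function of the right endpoint. To the right of
    \<open>v\<close> its derivative is positive, since the tangent slope of \<open>a\<close> exceeds
    the chord slope, which is \<open>a' y\<close> at an earlier \<open>y\<close>.\<close>
  define G where "G x = (a v + a x) / 2 * (x - v) - (F x - F v)" for x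
  have G: "(G has_real_derivative (a' x * (x - v) - (a x - a v)) / 2) (at x)" for x
    unfolding G_def
    by (rule derivative_eq_intros a F refl | simp add: field_simps)+
  obtain z where z: "v < z" "z < w" "G w - G v = (w - v) * ((a' z * (z - v) - (a z - a v)) / 2)"
    using MVT2[OF \<open>v < w\<close>, of G "\<lambda>x. (a' x * (x - v) - (a x - a v)) / 2"] G by blast
  obtain y where y: "v < y" "y < z" "a z - a v = (z - v) * a' y"
    using MVT2[OF \<open>v < z\<close>, of a a'] a by blast
  have "(z - v) * a' y < (z - v) * a' z"
    using mono[OF \<open>y < z\<close>] z by (intro mult_strict_left_mono) auto
  then have "a' z * (z - v) - (a z - a v) > 0" using y by (simp add: mult.commute)
  then have "G w - G v > 0" unfolding z(3) using \<open>v < w\<close> by (intro mult_pos_pos) auto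
  moreover have "G v = 0" by (simp add: G_def)
  ultimately show ?thesis by (simp add: G_def)
qed

text \<open>\<open>q i j\<close> stands for the product of the two coordinate differences,
  \<open>c1\<close> and \<open>c3\<close> for the constants relating it to two minors. Eliminating
  between the two relations leaves a sum \<open>b i + b j\<close> whose sign decides that of
  \<open>q i j\<close>.\<close>

lemma exists_constant_sign_row:
  fixes a F :: "real \<Rightarrow> real" and u v :: "'i \<Rightarrow> real" and q :: "'i \<Rightarrow> 'i \<Rightarrow> real"
  assumes fin: "finite I" "I \<noteq> {}"
    and a: "strict_mono a"
    and trap: "\<And>s t. s < t \<Longrightarrow> F t - F s < (a s + a t) / 2 * (t - s)"
    and inj: "\<And>i j. i \<in> I \<Longrightarrow> j \<in> I \<Longrightarrow> i \<noteq> j \<Longrightarrow> u i \<noteq> u j \<or> v i \<noteq> v j"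
    and m12: "\<And>i j. i \<in> I \<Longrightarrow> j \<in> I \<Longrightarrow> i \<noteq> j \<Longrightarrow>
      (u i - u j)\<^sup>2 - (v i - v j) * (a (v i) - a (v j)) = c1 * q i j"
    and m23: "\<And>i j. i \<in> I \<Longrightarrow> j \<in> I \<Longrightarrow> i \<noteq> j \<Longrightarrow>
      (a (v i) - a (v j)) * (((u i)\<^sup>2 / 2 + F (v i)) - ((u j)\<^sup>2 / 2 + F (v j)))
        - (u i - u j) * (u i * a (v i) - u j * a (v j)) = c3 * q i j"
  shows "\<exists>i\<in>I. \<exists>\<sigma>. \<forall>j\<in>I - {i}. \<sigma> * q i j > 0"
proof -
  define T where "T i j = (a (v i) + a (v j)) / 2 * (v i - v j) - (F (v i) - F (v j))" for i j
  have Ta: "T i j * (a (v i) - a (v j)) > 0" if "v i \<noteq> v j" for i j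
  proof (cases "v i < v j")
    case True
    then have "T i j < 0" using trap[OF True] by (simp add: T_def field_simps)
    then show ?thesis using strict_monoD[OF a True] by (simp add: mult_neg_neg)
  next
    case False
    then have "v j < v i" using that by simp
    then have "T i j > 0" using trap[of "v j" "v i"] by (simp add: T_def field_simps)
    then show ?thesis using strict_monoD[OF a \<open>v j < v i\<close>] by simp
  qed
  \<comment> \<open>The difference of \<open>u * a v\<close> is mean of \<open>u\<close> times
    difference of \<open>a\<close>, plus mean of \<open>a\<close> times difference of
    \<open>u\<close>; the terms with the mean of \<open>u\<close> cancel.\<close>
  have key: "c3 * q i j = - (a (v i) + a (v j)) / 2 * (c1 * q i j) - T i j * (a (v i) - a (v j))"
    if "i \<in> I" "j \<in> I" "i \<noteq> j" for i j
    unfolding m12[OF that, symmetric] m23[OF that, symmetric] T_def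
    by (simp add: field_simps power2_eq_square)
  show ?thesis
  proof (cases "c1 = 0")
    case True
    \<comment> \<open>With \<open>c1 = 0\<close>, equal \<open>v\<close> would force equal
      \<open>u\<close>; so \<open>T\<close> times the difference of \<open>a\<close> is positive for
      every pair, and any index serves.\<close>
    have "(- c3) * q i j > 0" if "i \<in> I" "j \<in> I" "i \<noteq> j" for i j
    proof -
      have "v i \<noteq> v j" using m12[OF that] inj[OF that] True by auto
      then show ?thesis using Ta key[OF that] True by simp
    qed
    then show ?thesis using fin by (metis DiffE all_not_in_conv insertI1)
  next
    case False
    \<comment> \<open>The deviation of \<open>a (v i)\<close> from the constant \<beta>
      \<open>= - c3 / c1\<close>.\<close>
    define b where "b i = a (v i) + c3 / c1" for i
    have sgn_b: "- (b i + b j) / 2 * (c1 * q i j) = T i j * (a (v i) - a (v j))"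
      if "i \<in> I" "j \<in> I" "i \<noteq> j" for i j
    proof -
      have "- (b i + b j) / 2 * (c1 * q i j) =
          - (a (v i) + a (v j)) / 2 * (c1 * q i j) - (c3 / c1 * c1) * q i j"
        by (simp add: b_def field_simps)
      then show ?thesis using key[OF that] False by simp
    qed
    \<comment> \<open>For a maximiser \<open>i\<close> of \<open>\<bar>b i\<bar>\<close>, no
      \<open>b i + b j\<close> has the sign opposite to \<open>b i\<close>.\<close>
    have "Max ((\<lambda>i. \<bar>b i\<bar>) ` I) \<in> (\<lambda>i. \<bar>b i\<bar>) ` I" using fin by (intro Max_in) auto
    then obtain i where i: "i \<in> I" "Max ((\<lambda>i. \<bar>b i\<bar>) ` I) = \<bar>b i\<bar>" by auto
    have max: "\<bar>b j\<bar> \<le> \<bar>b i\<bar>" if "j \<in> I" for j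
      using that i fin by (metis Max_ge finite_imageI imageI)
    \<comment> \<open>Equal \<open>v\<close> can occur only when \<open>b i = 0\<close>, and then
      with the sign of \<open>c1\<close>; therefore the value 0 is grouped with the negative case
      below.\<close>
    have eqv: "b i = 0 \<and> c1 * q i j > 0" if j: "j \<in> I" "i \<noteq> j" and "v i = v j" for j
    proof -
      have "c1 * q i j = (u i - u j)\<^sup>2" using m12[OF i(1) j] \<open>v i = v j\<close> by simp
      moreover have "u i \<noteq> u j" using inj[OF i(1) j] \<open>v i = v j\<close> by simp
      ultimately have "c1 * q i j > 0" by simp
      moreover have "b j = b i" using \<open>v i = v j\<close> by (simp add: b_def)
      ultimately show ?thesis using sgn_b[OF i(1) j] \<open>v i = v j\<close> by auto
    qed
    have neqv: "(b i + b j) * (c1 * q i j) < 0" if j: "j \<in> I" "i \<noteq> j" and "v i \<noteq> v j" for j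
    proof -
      have "(b i + b j) * (c1 * q i j) = -2 * (T i j * (a (v i) - a (v j)))"
        unfolding sgn_b[OF i(1) j, symmetric] by (simp add: field_simps)
      then show ?thesis using Ta[OF \<open>v i \<noteq> v j\<close>] by linarith
    qed
    show ?thesis
    proof (cases "b i > 0")
      case True
      have "(- c1) * q i j > 0" if j: "j \<in> I" "i \<noteq> j" for j
      proof -
        have "v i \<noteq> v j" using eqv[OF j] True by auto
        then show ?thesis using neqv[OF j] max[OF j(1)] True
          by (auto simp: mult_less_0_iff)
      qed
      then show ?thesis using i by (metis DiffE insertI1)
    next
      case False
      have "c1 * q i j > 0" if j: "j \<in> I" "i \<noteq> j" for j
      proof (cases "v i = v j")
        case True
        then show ?thesis using eqv[OF j] by blast
      next
        case False
        then show ?thesis using neqv[OF j] max[OF j(1)] \<open>\<not> b i > 0\<close>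
          by (auto simp: mult_less_0_iff)
      qed
      then show ?thesis using i by (metis DiffE insertI1)
    qed
  qed
qed

section \<open>Two-by-two minors and rank one\<close>

definition minor :: "3 \<Rightarrow> 3 \<Rightarrow> real^2^3 \<Rightarrow> real" where
  "minor k l A = A$k$1 * A$l$2 - A$k$2 * A$l$1"

text \<open>The polarisation of the quadratic form \<open>minor k l\<close>.\<close>

definition polar_minor :: "3 \<Rightarrow> 3 \<Rightarrow> real^2^3 \<Rightarrow> real^2^3 \<Rightarrow> real" where
  "polar_minor k l A B = A$k$1 * B$l$2 + B$k$1 * A$l$2 - A$k$2 * B$l$1 - B$k$2 * A$l$1"

lemma minor_combination:
  "minor k l (s *\<^sub>R A + t *\<^sub>R B) = s\<^sup>2 * minor k l A + s * t * polar_minor k l A B + t\<^sup>2 * minor k l B"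
  by (simp add: minor_def polar_minor_def algebra_simps power2_eq_square)

lemma minor_eq_0_if_rank_1:
  fixes A :: "real^2^3"
  assumes "rank A = 1"
  shows "minor k l A = 0"
proof (rule ccontr)
  assume m: "minor k l A \<noteq> 0"
  have ind: "x = 0 \<and> y = 0" if "x *\<^sub>R A$k + y *\<^sub>R A$l = 0" for x y
  proof -
    have e: "x * A$k$1 + y * A$l$1 = 0" "x * A$k$2 + y * A$l$2 = 0"
      using arg_cong[OF that, of "\<lambda>z. z$1"] arg_cong[OF that, of "\<lambda>z. z$2"] by auto
    \<comment> \<open>Cramer's rule for the coefficients of a vanishing combination of two
      rows.\<close>
    have "x * minor k l A = (x * A$k$1 + y * A$l$1) * A$l$2 - (x * A$k$2 + y * A$l$2) * A$l$1"
      "y * minor k l A = (x * A$k$2 + y * A$l$2) * A$k$1 - (x * A$k$1 + y * A$l$1) * A$k$2"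
      by (simp_all add: minor_def algebra_simps)
    then have "x * minor k l A = 0" "y * minor k l A = 0" by (simp_all only: e)
    then show ?thesis using m by simp
  qed
  have ne: "A$k \<noteq> A$l" using m by (auto simp: minor_def)
  have "independent {A$k, A$l}"
    unfolding independent_explicit using ne ind by auto
  then have "card {A$k, A$l} \<le> dim (rows A)"
    by (intro independent_card_le_dim) (auto simp: rows_def row_def)
  then show False using ne assms by (simp add: row_rank_def)
qed

lemma rank_1_if_minors_eq_0:
  fixes A :: "real^2^3"
  assumes "A \<noteq> 0" and m: "\<And>k l. minor k l A = 0"
  shows "rank A = 1"
proof -
  obtain k n where kn: "A$k$n \<noteq> 0"
    using \<open>A \<noteq> 0\<close> by (auto simp: vec_eq_iff)
  have "A$l = (A$l$n / A$k$n) *\<^sub>R A$k" for l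
    using m[of k l] kn exhaust_2[of n]
    by (auto simp: vec_eq_iff forall_2 minor_def field_simps)
  then have "rows A \<subseteq> span {A$k}"
    by (auto simp: rows_def row_def span_singleton)
  then have "dim (rows A) \<le> card {A$k}"
    by (intro dim_le_card) auto
  moreover have "rank A \<noteq> 0" using \<open>A \<noteq> 0\<close> by (simp only: rank_eq_0 not_False_eq_True)
  ultimately show ?thesis unfolding row_rank_def by (metis One_nat_def card.empty card.insert empty_iff finite.emptyI le_SucE le_zero_eq)
qed

section \<open>The polygon of a planar configuration\<close>

text \<open>Since the \<open>C i\<close> sum to zero, the polygon closes and unrolls periodically
  over all naturals, so that a tour may start at any index. Indices shift by one: vertex
  \<open>P n\<close> precedes the point \<open>n + 1\<close>.\<close>

lemma forms_TN_periodic: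
  fixes X :: "nat \<Rightarrow> real^'n^'m"
  assumes "forms_TN N X"
  obtains P C \<kappa> where
    "\<And>n. P (n + N) = P n" "\<And>n. \<kappa> n > (1::real)" "\<And>n. rank (C n) = 1"
    "\<And>n. P (Suc n) = P n + C n" "\<And>n. X (Suc (n mod N)) = P n + \<kappa> n *\<^sub>R C n"
proof -
  obtain P0 C \<kappa> where N: "N \<ge> 4"
    and C: "\<And>i. i \<in> {1..N} \<Longrightarrow> \<kappa> i > (1::real) \<and> rank (C i) = 1"
    and sum: "(\<Sum>i=1..N. C i) = 0"
    and X: "\<And>i. i \<in> {1..N} \<Longrightarrow> X i = P0 + (\<Sum>j=1..<i. C j) + \<kappa> i *\<^sub>R C i"
    using assms unfolding forms_TN_def by blast
  have in_range: "Suc (n mod N) \<in> {1..N}" for n using N by (simp add: Suc_le_eq)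
  define P where "P n = P0 + (\<Sum>j=1..<Suc (n mod N). C j)" for n
  have step: "P (Suc n) = P n + C (Suc (n mod N))" for n
  proof (cases "Suc (n mod N) = N")
    case True
    then have "(\<Sum>j=1..<Suc (n mod N). C j) + C (Suc (n mod N)) = 0"
      using sum N by (metis One_nat_def Suc_le_mono atLeastLessThanSuc_atLeastAtMost le0 sum.atLeastLessThan_Suc)
    moreover have "Suc n mod N = 0" using True by (simp add: mod_Suc)
    ultimately show ?thesis by (simp add: P_def add.assoc)
  next
    case False
    then have "Suc n mod N = Suc (n mod N)" by (simp add: mod_Suc)
    then show ?thesis by (simp add: P_def add.assoc)
  qed
  show thesis
  proof (rule that[of P "\<lambda>n. \<kappa> (Suc (n mod N))" "\<lambda>n. C (Suc (n mod N))"])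
    show "P (n + N) = P n" for n by (simp add: P_def)
  qed (use C X in_range step in \<open>auto simp: P_def\<close>)
qed

text \<open>One tour writes \<open>P N\<close> as an affine combination of \<open>P 0\<close> and a
  point \<open>Z\<close> of \<open>A\<close>, with weight of \<open>P 0\<close> below 1; as
  \<open>P N = P 0\<close>, this forces \<open>P 0 = Z\<close>.\<close>

lemma polygon_in_affine:
  fixes P C X :: "nat \<Rightarrow> 'a::real_vector"
  assumes A: "affine A" and X: "\<And>n. X n \<in> A" and "N > 0" "P N = P 0"
    and \<kappa>: "\<And>n. \<kappa> n > (1::real)"
    and step: "\<And>n. P (Suc n) = P n + C n" "\<And>n. X n = P n + \<kappa> n *\<^sub>R C n"
  shows "P n \<in> A"
proof -
  have conv: "P (Suc n) = (1 - 1 / \<kappa> n) *\<^sub>R P n + (1 / \<kappa> n) *\<^sub>R X n" for n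
    using \<kappa>[of n] step by (simp add: algebra_simps)
  have aff: "(1 - t) *\<^sub>R x + t *\<^sub>R y \<in> A" if "x \<in> A" "y \<in> A" for x y t
    using A that by (simp add: affine_def)
  have "\<exists>t Z. 0 < t \<and> t < 1 \<and> Z \<in> A \<and> P (Suc n) = t *\<^sub>R P 0 + (1 - t) *\<^sub>R Z" for n
  proof (induction n)
    case 0
    show ?case
      using conv[of 0] X[of 0] \<kappa>[of 0]
      by (intro exI[of _ "1 - 1 / \<kappa> 0"] exI[of _ "X 0"]) auto
  next
    case (Suc n)
    then obtain t Z where t: "0 < t" "t < 1" "Z \<in> A" "P (Suc n) = t *\<^sub>R P 0 + (1 - t) *\<^sub>R Z"
      by blast
    define l where "l = 1 / \<kappa> (Suc n)"
    have l: "0 < l" "l < 1" using \<kappa>[of "Suc n"] by (auto simp: l_def)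
    define s where "s = (1 - l) * t"
    have s: "0 < s" "s < 1"
      using l t mult_strict_mono[of "1 - l" 1 t 1] by (auto simp: s_def)
    \<comment> \<open>The weight of the new point once the share \<open>s\<close> of
      \<open>P 0\<close> is split off and the rest is normalised.\<close>
    define m where "m = l / (1 - s)"
    have m: "(1 - s) * m = l" "(1 - s) * (1 - m) = (1 - l) * (1 - t)"
      using s by (simp_all add: m_def right_diff_distrib) (simp add: s_def algebra_simps)
    have "P (Suc (Suc n)) = s *\<^sub>R P 0 + ((1 - l) * (1 - t)) *\<^sub>R Z + l *\<^sub>R X (Suc n)"
      unfolding conv[of "Suc n"] t(4) l_def[symmetric] s_def by (simp add: scaleR_add_right)
    also have "\<dots> = s *\<^sub>R P 0 + (1 - s) *\<^sub>R ((1 - m) *\<^sub>R Z + m *\<^sub>R X (Suc n))"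
      by (simp only: scaleR_add_right scaleR_scaleR m add.assoc)
    finally show ?case using s aff[OF t(3) X[of "Suc n"], of m] by blast
  qed
  then obtain t Z where t: "t < 1" "Z \<in> A" "P 0 = t *\<^sub>R P 0 + (1 - t) *\<^sub>R Z"
    using assms(3,4) by (metis gr0_implies_Suc)
  from t(3) have "(1 - t) *\<^sub>R P 0 = (1 - t) *\<^sub>R Z" by (simp add: algebra_simps)
  then have "P 0 \<in> A" using t by simp
  then show ?thesis
    by (induction n) (use conv aff X in auto)
qed

lemma plane_directions_span:
  assumes "affine_plane P" "p \<in> P" "independent {A, B}" "A \<noteq> B"
    and "p + A \<in> P" "p + B \<in> P" "z \<in> P"
  shows "z - p \<in> span {A, B}"
proof -
  have "dim ((\<lambda>x. x - p) ` P) = 2"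
    using assms aff_dim_eq_dim_subtract[of p P] hull_inc[of p P affine]
    by (simp add: affine_plane_def)
  moreover have "{A, B} \<subseteq> (\<lambda>x. x - p) ` P"
    using assms by (auto intro: image_eqI[of _ _ "p + A"] image_eqI[of _ _ "p + B"])
  ultimately have "(\<lambda>x. x - p) ` P \<subseteq> span {A, B}"
    using assms by (intro card_ge_dim_independent) auto
  then show ?thesis using assms by auto
qed

text \<open>\<open>q i j\<close> is the product of the coordinate differences along two rank-one
  directions, and \<open>b k l\<close> their polarised minor. The second conclusion is the staircase
  obstruction, valid for any planar configuration.\<close>

lemma plane_TN_minors:
  fixes X :: "nat \<Rightarrow> real^2^3"
  assumes TN: "forms_TN N X" and P: "affine_plane P" "X ` {1..N} \<subseteq> P"
  obtains q :: "nat \<Rightarrow> nat \<Rightarrow> real" and b :: "3 \<Rightarrow> 3 \<Rightarrow> real" where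
    "\<And>k l i j. i \<in> {1..N} \<Longrightarrow> j \<in> {1..N} \<Longrightarrow> minor k l (X i - X j) = b k l * q i j"
    "\<not> (\<exists>i\<in>{1..N}. \<exists>\<sigma>. \<forall>j\<in>{1..N} - {i}. \<sigma> * q i j > 0)"
proof -
  have N: "N \<ge> 4" and inj: "inj_on X {1..N}"
    and no_conn: "\<not> has_rank_one_connections (X ` {1..N})"
    using TN by (auto simp: forms_TN_def)
  have minor_ne: "\<exists>k l. minor k l (X i - X j) \<noteq> 0"
    if "i \<in> {1..N}" "j \<in> {1..N}" "i \<noteq> j" for i j
  proof -
    have "X i \<noteq> X j" using inj that by (auto dest: inj_onD)
    moreover have "rank (X i - X j) \<noteq> 1"
      using no_conn that \<open>X i \<noteq> X j\<close> unfolding has_rank_one_connections_def by blast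
    ultimately show ?thesis using rank_1_if_minors_eq_0[of "X i - X j"] by auto
  qed
  obtain Q C \<kappa> where per: "\<And>n. Q (n + N) = Q n" and \<kappa>: "\<And>n. \<kappa> n > (1::real)"
    and C: "\<And>n. rank (C n) = 1" and Q: "\<And>n. Q (Suc n) = Q n + C n"
    and X: "\<And>n. X (Suc (n mod N)) = Q n + \<kappa> n *\<^sub>R C n"
    by (rule forms_TN_periodic[OF TN], rule that)
  define Y where "Y n = X (Suc (n mod N))" for n
  have in_range: "Suc (n mod N) \<in> {1..N}" for n using N by (simp add: Suc_le_eq)
  have affP: "affine P" using P by (simp add: affine_plane_def)
  have YP: "Y n \<in> P" for n
    unfolding Y_def using P(2) in_range by blast
  have Y: "Y n = Q n + \<kappa> n *\<^sub>R C n" for n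
    using X by (simp add: Y_def)
  have QP: "Q n \<in> P" for n
    by (rule polygon_in_affine[of P Y N Q \<kappa> C]) (use affP YP N per[of 0] \<kappa> Q Y in auto)
  have C0: "C n \<noteq> 0" for n using C[of n] by auto

  \<comment> \<open>Two consecutive edges give the two directions: were they parallel,
    \<open>X 2 - X 1\<close> would be a multiple of \<open>C 0\<close>, a rank-one
    connection.\<close>
  have C1: "C 1 \<notin> span {C 0}"
  proof
    assume "C 1 \<in> span {C 0}"
    then have "C 0 + \<kappa> 1 *\<^sub>R C 1 - \<kappa> 0 *\<^sub>R C 0 \<in> span {C 0}"
      by (intro span_add span_diff span_scale) (auto simp: span_base)
    moreover have "X 2 - X 1 = C 0 + \<kappa> 1 *\<^sub>R C 1 - \<kappa> 0 *\<^sub>R C 0"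
      using X[of 0] X[of 1] N by (simp add: Q numeral_2_eq_2)
    ultimately obtain s where "X 2 - X 1 = s *\<^sub>R C 0"
      by (auto simp: span_singleton)
    then have "minor k l (X 2 - X 1) = 0" for k l
      using minor_combination[of k l s "C 0" 0 0] minor_eq_0_if_rank_1[OF C] by simp
    then show False using minor_ne[of 2 1] N by simp
  qed
  define A B where "A = C 0" and "B = C 1"
  have AB: "A \<noteq> B" using C1 by (auto simp: A_def B_def span_base)
  have ind: "independent {A, B}"
    using C1 C0 AB independent_insertI[of "C 1" "{C 0}"] by (simp add: A_def B_def insert_commute)
  \<comment> \<open>This is the affine combination \<open>Q 0 + Q (Suc n) - Q n\<close>.\<close>
  have "Q 0 + C n \<in> P" for n
    using mem_affine_3_minus[OF affP QP[of 0] QP[of "Suc n"] QP[of n], of 1] by (simp add: Q)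
  then have span_P: "z - Q 0 \<in> span {A, B}" if "z \<in> P" for z
    using plane_directions_span[OF P(1) QP ind AB _ _ that] by (simp add: A_def B_def)
  have span_diff_P: "z - w \<in> span {A, B}" if "z \<in> P" "w \<in> P" for z w
    using span_diff[OF span_P[OF that(1)] span_P[OF that(2)]] by simp
  \<comment> \<open>Coordinate functionals for the basis \<open>A\<close>, \<open>B\<close>,
    extended to all matrices.\<close>
  obtain f g :: "real^2^3 \<Rightarrow> real" where f: "linear f" "f A = 1" "f B = 0"
    and g: "linear g" "g A = 0" "g B = 1"
    using linear_independent_extend[OF ind, of "\<lambda>x. if x = A then 1 else 0 :: real"]
      linear_independent_extend[OF ind, of "\<lambda>x. if x = B then 1 else 0 :: real"] AB
    by auto
  have coords: "z = f z *\<^sub>R A + g z *\<^sub>R B" if "z \<in> span {A, B}" for z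
  proof -
    from that obtain s t where "z = s *\<^sub>R A + t *\<^sub>R B"
      by (auto simp: span_insert span_singleton algebra_simps)
    moreover from this have "f z = s" "g z = t"
      using f g by (simp_all add: linear_add linear_scale)
    ultimately show ?thesis by simp
  qed
  have minor_span: "minor m l z = polar_minor m l A B * (f z * g z)" if "z \<in> span {A, B}" for z m l
    using arg_cong[OF coords[OF that], of "minor m l"] minor_eq_0_if_rank_1[OF C]
    by (simp add: minor_combination) (simp add: A_def B_def)

  define q where "q i j = (f (X j) - f (X i)) * (g (X j) - g (X i))" for i j
  have mq: "minor m l (X i - X j) = polar_minor m l A B * q i j"
    if "i \<in> {1..N}" "j \<in> {1..N}" for m l i j
    using minor_span[of "X i - X j" m l] span_diff_P that P(2) f g
    by (simp add: q_def linear_diff image_subset_iff algebra_simps)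
  \<comment> \<open>A nonzero polarised minor exists because \<open>X 1\<close> and
    \<open>X 2\<close> are not rank-one connected; it makes every rank-one edge parallel to
    \<open>A\<close> or \<open>B\<close>.\<close>
  obtain m l where "polar_minor m l A B \<noteq> 0"
    using minor_ne[of 1 2] mq[of 1 2] N by auto
  moreover have "C n \<in> span {A, B}" for n
    using span_diff_P[OF QP[of "Suc n"] QP[of n]] by (simp add: Q)
  ultimately have fg: "f (C n) = 0 \<or> g (C n) = 0" for n
    using minor_span[of "C n" m l] minor_eq_0_if_rank_1[OF C] by simp
  have fg_ne: "f (C n) \<noteq> 0 \<or> g (C n) \<noteq> 0" for n
    using coords[of "C n"] \<open>C n \<in> span {A, B}\<close> C0[of n] by auto

  have "\<not> (\<forall>j\<in>{1..N} - {i}. \<sigma> * q i j > 0)" if "i \<in> {1..N}" for i \<sigma>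
  proof
    assume sgn: "\<forall>j\<in>{1..N} - {i}. \<sigma> * q i j > 0"
    define i' where "i' = i - 1"
    have i': "i' < N" "Suc i' = i" using that by (auto simp: i'_def)
    have Yi: "Y i' = X i" using i' by (simp add: Y_def)
    have pos: "\<sigma> * ((f (Y n) - f (Y i')) * (g (Y n) - g (Y i'))) > 0" if "i' < n" "n < i' + N" for n
    proof -
      have "n mod N \<noteq> i'"
      proof
        assume "n mod N = i'"
        then have "N dvd n - i'" using mod_eq_dvd_iff_nat[of i' n N] that i' by simp
        then show False using that by (auto dest: dvd_imp_le)
      qed
      then have "Suc (n mod N) \<in> {1..N} - {i}" using in_range[of n] i' by auto
      then show ?thesis using sgn Yi by (auto simp: q_def Y_def)
    qed
    \<comment> \<open>As \<open>Y n - Q n\<close> is \<open>\<kappa> n\<close> times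
      \<open>C n\<close>, each step covers the fraction \<open>1 / \<kappa> n\<close> of the way to
      \<open>Y n\<close>.\<close>
    show False
    proof (rule closed_staircase_no_monotone_corner[where p = "\<lambda>n. f (Q n)" and r = "\<lambda>n. g (Q n)"
          and x = "\<lambda>n. f (Y n)" and y = "\<lambda>n. g (Y n)" and l = "\<lambda>n. 1 / \<kappa> n" and i = i'
          and N = N and \<sigma> = \<sigma>])
      show "0 < 1 / \<kappa> n \<and> 1 / \<kappa> n < 1" for n using \<kappa>[of n] by simp
      show "f (Q (Suc n)) = f (Q n) + 1 / \<kappa> n * (f (Y n) - f (Q n)) \<and>
          g (Q (Suc n)) = g (Q n) + 1 / \<kappa> n * (g (Y n) - g (Q n))" for n
        using \<kappa>[of n] f(1) g(1) by (simp add: Y Q linear_add linear_scale)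
      show "f (Y n) = f (Q n) \<or> g (Y n) = g (Q n)" for n
        using fg[of n] f(1) g(1) by (auto simp: Y linear_add linear_scale)
      show "f (Y i') \<noteq> f (Q i') \<or> g (Y i') \<noteq> g (Q i')"
        using fg_ne[of i'] \<kappa>[of i'] f(1) g(1) by (auto simp: Y linear_add linear_scale)
    qed (use N per pos in auto)
  qed
  then show thesis using mq by (intro that[of "\<lambda>m l. polar_minor m l A B" q]) blast+
qed

theorem corollary1p3:
  fixes a F :: "real \<Rightarrow> real" and N :: nat and X :: "nat \<Rightarrow> real^2^3"
  assumes "C2_fun a"
    and "\<And>v. deriv a v > 0"
    and "\<And>v. deriv (deriv a) v > 0"
    and "\<And>v. (F has_real_derivative a v) (at v)"
    and "N \<ge> 6"
    and "X ` {1..N} \<subseteq> K_set a F"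
    and "\<exists>P. affine_plane P \<and> X ` {1..N} \<subseteq> K_set a F \<inter> P"
  shows "\<not> has_TN_order N X"
proof
  assume "has_TN_order N X"
  then obtain \<pi> where \<pi>: "\<pi> permutes {1..N}" and TN: "forms_TN N (X \<circ> \<pi>)"
    by (auto simp: has_TN_order_def)
  define Y where "Y = X \<circ> \<pi>"
  have img: "Y ` {1..N} = X ` {1..N}"
    using permutes_image[OF \<pi>] by (metis Y_def image_comp)
  obtain P where P: "affine_plane P" "Y ` {1..N} \<subseteq> P" using assms(7) unfolding img by blast
  obtain q :: "nat \<Rightarrow> nat \<Rightarrow> real" and b where
    mq: "\<And>k l i j. i \<in> {1..N} \<Longrightarrow> j \<in> {1..N} \<Longrightarrow> minor k l (Y i - Y j) = b k l * q i j"
    and no_row: "\<not> (\<exists>i\<in>{1..N}. \<exists>\<sigma>. \<forall>j\<in>{1..N} - {i}. \<sigma> * q i j > 0)"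
    by (rule plane_TN_minors[OF TN[folded Y_def] P], rule that)
  have "Y ` {1..N} \<subseteq> K_set a F" using assms(6) unfolding img .
  then have "\<forall>i\<in>{1..N}. \<exists>u v. Y i = vector [vector [u, v], vector [a v, u], vector [u * a v, u\<^sup>2 / 2 + F v]]"
    unfolding K_set_def by blast
  then obtain u v where Y: "\<And>i. i \<in> {1..N} \<Longrightarrow>
      Y i = vector [vector [u i, v i], vector [a (v i), u i], vector [u i * a (v i), (u i)\<^sup>2 / 2 + F (v i)]]"
    by metis
  have inj_Y: "inj_on Y {1..N}"
    using TN[folded Y_def] unfolding forms_TN_def by blast
  have inj: "u i \<noteq> u j \<or> v i \<noteq> v j" if "i \<in> {1..N}" "j \<in> {1..N}" "i \<noteq> j" for i j
    using inj_onD[OF inj_Y _ that(1,2)] Y[OF that(1)] Y[OF that(2)] that(3) by auto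

  have a: "(a has_real_derivative deriv a x) (at x)"
    and a': "(deriv a has_real_derivative deriv (deriv a) x) (at x)" for x
    using assms(1) C1_diff_imp_diff[of _ UNIV]
    by (auto simp: C2_fun_def DERIV_deriv_iff_real_differentiable differentiable_on_def)
  have "strict_mono a"
    by (rule strict_monoI, rule DERIV_pos_imp_increasing) (use a assms(2) in blast)+
  moreover have "deriv a x < deriv a y" if "x < y" for x y
    by (rule DERIV_pos_imp_increasing[OF that]) (use a' assms(3) in blast)
  \<comment> \<open>The required relations are the minors of rows 1, 2 and of rows 2, 3 of
    \<open>Y i - Y j\<close>, written in the parameters \<open>u\<close>, \<open>v\<close>.\<close>
  ultimately have "\<exists>i\<in>{1..N}. \<exists>\<sigma>. \<forall>j\<in>{1..N} - {i}. \<sigma> * q i j > 0"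
  proof (intro exists_constant_sign_row[where a = a and F = F and u = u and v = v
        and ?c1.0 = "b 1 2" and ?c3.0 = "b 2 3"])
    show "(u i - u j)\<^sup>2 - (v i - v j) * (a (v i) - a (v j)) = b 1 2 * q i j"
      if "i \<in> {1..N}" "j \<in> {1..N}" "i \<noteq> j" for i j
      using mq[OF that(1,2), of 1 2] Y[OF that(1)] Y[OF that(2)]
      by (simp add: minor_def power2_eq_square)
    show "(a (v i) - a (v j)) * (((u i)\<^sup>2 / 2 + F (v i)) - ((u j)\<^sup>2 / 2 + F (v j)))
        - (u i - u j) * (u i * a (v i) - u j * a (v j)) = b 2 3 * q i j"
      if "i \<in> {1..N}" "j \<in> {1..N}" "i \<noteq> j" for i j
      using mq[OF that(1,2), of 2 3] Y[OF that(1)] Y[OF that(2)]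
      by (simp add: minor_def)
  qed (use inj assms(5) trapezoid_strict[OF a _ assms(4)] in auto)
  then show False using no_row by blast
qed

end
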